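(* Let $x>0$, $n>s\ge 1$, and let $$A=\begin{bmatrix} C_s(x) & J_{s,n-s}\\ J_{n-s,s} & J_{n-s}\end{bmatrix}.$$ Then the Perron eigenvector of $A$ is efficient for $A$.
   Context: For $x>0$, $C_s(x)=[a_{ij}]$ is the $s$-by-$s$ matrix with $a_{ii}=1$, $a_{ij}=x$ for $j>i$ and $a_{ij}=1/x$ for $j<i$. $J_{m,k}$ denotes the $m$-by-$k$ all-ones matrix, $J_m=J_{m,m}$. The Perron eigenvector of a positive square matrix is a positive eigenvector associated with its spectral radius (unique up to a positive scalar factor). A vector $w$ with positive entries is efficient for a reciprocal matrix $A$ (an entrywise positive matrix with $a_{ji}=1/a_{ij}$) if, for every positive vector $v$, the entrywise inequality $\left|A-[v_i/v_j]\right|\le\left|A-[w_i/w_j]\right|$ implies $v=w$.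
   Formalization: In the definition of efficiency the conclusion "v = w" is read as "v = cw for some c > 0", since v = 2w gives the same ratio matrix, so with literal equality no vector would be efficient. *)

theory Defs
  imports "Jordan_Normal_Form.Spectral_Radius"
begin

definition C_mat :: "nat \<Rightarrow> real \<Rightarrow> real mat" where
  "C_mat s x = mat s s (\<lambda>(i, j). if i = j then 1 else if i < j then x else 1 / x)"

definition J_mat :: "nat \<Rightarrow> nat \<Rightarrow> real mat" where
  "J_mat m k = mat m k (\<lambda>(i, j). 1)"

definition positive_vec :: "real vec \<Rightarrow> bool" where
  "positive_vec w \<longleftrightarrow> (\<forall>i < dim_vec w. 0 < w $ i)"

definition positive_mat :: "real mat \<Rightarrow> bool" where
  "positive_mat A \<longleftrightarrow> (\<forall>i < dim_row A. \<forall>j < dim_col A. 0 < A $$ (i, j))"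

definition reciprocal_mat :: "real mat \<Rightarrow> bool" where
  "reciprocal_mat A \<longleftrightarrow> square_mat A \<and> positive_mat A \<and>
     (\<forall>i < dim_row A. \<forall>j < dim_row A. A $$ (j, i) = 1 / A $$ (i, j))"

text \<open>The spectral radius is taken over the complex spectrum. A Perron eigenvector is only
  determined up to a positive factor, hence a predicate rather than a function of the matrix.\<close>

definition perron_eigenvector :: "real mat \<Rightarrow> real vec \<Rightarrow> bool" where
  "perron_eigenvector A w \<longleftrightarrow>
     positive_vec w \<and> eigenvector A w (spectral_radius (map_mat complex_of_real A))"

definition ratio_mat :: "real vec \<Rightarrow> real mat" where
  "ratio_mat w = mat (dim_vec w) (dim_vec w) (\<lambda>(i, j). w $ i / w $ j)"

text \<open>The matrix \<^term>\<open>ratio_mat v\<close> is unchanged when \<^term>\<open>v\<close> is multiplied by a positive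
  number, so the conclusion ``\<^term>\<open>v\<close> equals \<^term>\<open>w\<close>'' in the notion of efficiency
  is equality up to a positive factor; under literal equality no vector would be efficient.\<close>

definition efficient :: "real mat \<Rightarrow> real vec \<Rightarrow> bool" where
  "efficient A w \<longleftrightarrow> reciprocal_mat A \<and> w \<in> carrier_vec (dim_row A) \<and> positive_vec w \<and>
     (\<forall>v \<in> carrier_vec (dim_row A). positive_vec v \<longrightarrow>
        (\<forall>i < dim_row A. \<forall>j < dim_row A.
           \<bar>(A - ratio_mat v) $$ (i, j)\<bar> \<le> \<bar>(A - ratio_mat w) $$ (i, j)\<bar>) \<longrightarrow>
        (\<exists>c > 0. v = c \<cdot>\<^sub>v w))"

end

theory Submission
  imports Defs
begin

text \<open>
  Draw an edge from \<open>i\<close> to \<open>j\<close> when \<open>w\<^sub>i / w\<^sub>j \<ge> a\<^sub>i\<^sub>j\<close>. If \<open>v\<close> approximates \<open>A\<close> at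
  least as well as \<open>w\<close> does, then \<open>v\<^sub>i / w\<^sub>i \<le> v\<^sub>j / w\<^sub>j\<close> along every edge, so \<open>w\<close> is efficient as soon
  as this digraph is strongly connected.

  Let \<open>A w = \<rho> w\<close> with \<open>w\<close> positive. The last \<open>n - s\<close> entries of \<open>w\<close> have a common value \<open>t\<close>, and
  \<open>\<rho> t\<close> is the sum of all entries. Suppose \<open>x \<ge> 1\<close>. Comparing the first and the last row of the
  block \<open>C\<^sub>s(x)\<close> with a row of ones gives \<open>w\<^sub>1 \<ge> t \<ge> w\<^sub>s\<close>, hence \<open>\<rho> t \<ge> w\<^sub>1 + t \<ge> 2 t\<close> and
  \<open>\<rho> \<ge> 2\<close>. Subtracting consecutive rows of the block gives
  \<open>(\<rho> - 1 + 1/x) w\<^sub>i = (\<rho> - 1 + x) w\<^sub>i\<^sub>+\<^sub>1\<close>, and \<open>\<rho> \<ge> 2\<close> then yields \<open>w\<^sub>i \<le> x w\<^sub>i\<^sub>+\<^sub>1\<close>.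
  So \<open>1 \<rightarrow> k \<rightarrow> s \<rightarrow> s - 1 \<rightarrow> \<dots> \<rightarrow> 1\<close> is a cycle for every \<open>k > s\<close>. For \<open>x \<le> 1\<close> the order of
  the first \<open>s\<close> indices is reversed.
\<close>

definition dominance_graph :: "real mat \<Rightarrow> real vec \<Rightarrow> (nat \<times> nat) set" where
  "dominance_graph A w =
     {(i, j). i < dim_row A \<and> j < dim_row A \<and> A $$ (i, j) \<le> w $ i / w $ j}"

lemma efficient_if_strongly_connected:
  assumes A: "reciprocal_mat A" and w: "w \<in> carrier_vec (dim_row A)" "positive_vec w"
    and conn: "\<And>i j. i < dim_row A \<Longrightarrow> j < dim_row A \<Longrightarrow> (i, j) \<in> (dominance_graph A w)\<^sup>*"
  shows "efficient A w"
  unfolding efficient_def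
proof (intro conjI ballI impI)
  fix v assume v: "v \<in> carrier_vec (dim_row A)" "positive_vec v"
    and le: "\<forall>i<dim_row A. \<forall>j<dim_row A.
      \<bar>(A - ratio_mat v) $$ (i, j)\<bar> \<le> \<bar>(A - ratio_mat w) $$ (i, j)\<bar>"
  let ?n = "dim_row A"
  have wpos: "0 < w $ i" and vpos: "0 < v $ i" if "i < ?n" for i
    using w v that by (auto simp: positive_vec_def)
  have edge: "v $ i / w $ i \<le> v $ j / w $ j" if "(i, j) \<in> dominance_graph A w" for i j
  proof -
    have ij: "i < ?n" "j < ?n" and a: "A $$ (i, j) \<le> w $ i / w $ j"
      using that by (auto simp: dominance_graph_def)
    have "\<bar>A $$ (i, j) - v $ i / v $ j\<bar> \<le> \<bar>A $$ (i, j) - w $ i / w $ j\<bar>"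
      using le[rule_format, OF ij] ij v(1) w(1) by (simp add: ratio_mat_def)
    \<comment> \<open>Along an edge the right-hand side equals
      \<open>w $ i / w $ j - A $$ (i, j)\<close>, so it caps \<open>v $ i / v $ j\<close> from
      above.\<close>
    with a have "v $ i / v $ j \<le> w $ i / w $ j" by linarith
    then show ?thesis
      using wpos[OF ij(1)] wpos[OF ij(2)] vpos[OF ij(2)] by (simp add: field_simps)
  qed
  have path: "v $ i / w $ i \<le> v $ j / w $ j" if "(i, j) \<in> (dominance_graph A w)\<^sup>*" for i j
    using that by induction (auto dest: edge)
  show "\<exists>c>0. v = c \<cdot>\<^sub>v w"
  proof (cases "?n = 0")
    case True
    then show ?thesis using v(1) w(1) by (intro exI[of _ 1]) auto
  next
    case False
    define c where "c = v $ 0 / w $ 0"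
    have "v $ i = c * w $ i" if i: "i < ?n" for i
    proof -
      have "v $ i / w $ i = c"
        \<comment> \<open>Paths in both directions between \<open>i\<close> and \<open>0\<close>
          turn the monotone quotient into a constant one.\<close>
        unfolding c_def using path[OF conn[of i 0]] path[OF conn[of 0 i]] i False by force
      then show ?thesis using wpos[OF i] by (simp add: field_simps)
    qed
    then have "v = c \<cdot>\<^sub>v w"
      using v(1) w(1) by (intro eq_vecI) auto
    moreover have "0 < c" using wpos[of 0] vpos[of 0] False by (simp add: c_def)
    ultimately show ?thesis by blast
  qed
qed (use A w in auto)

lemma increasing_path_in_rtrancl:
  fixes R :: "(nat \<times> nat) set"
  assumes "\<And>i. Suc i < s \<Longrightarrow> (i, Suc i) \<in> R" and "i \<le> j" "j < s"
  shows "(i, j) \<in> R\<^sup>*"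
  using assms(2,3)
proof (induction j rule: dec_induct)
  case (step k)
  then show ?case using assms(1)[of k] by (simp add: rtrancl.rtrancl_into_rtrancl)
qed simp

definition C_entry :: "real \<Rightarrow> nat \<Rightarrow> nat \<Rightarrow> real" where
  "C_entry x i j = (if i = j then 1 else if i < j then x else 1 / x)"

text \<open>Reversal of the indices swaps the two triangles, hence \<open>x\<close> and
  \<open>1 / x\<close>.\<close>

lemma C_entry_reverse:
  assumes "i < s" "j < s"
  shows "C_entry x (s - Suc i) (s - Suc j) = C_entry (1 / x) i j"
  using assms by (auto simp: C_entry_def)

text \<open>Here \<open>f\<close> stands for the entries of the eigenvector in the block,
  \<open>t\<close> for the common value of the others and \<open>q\<close> for their sum. Indices
  start at 0, so the last row of the block is \<open>s - 1\<close>.\<close>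

lemma C_eigenvector_bounds:
  fixes f :: "nat \<Rightarrow> real"
  assumes x: "x \<ge> 1" and s: "s \<ge> 1" and f: "\<And>i. i < s \<Longrightarrow> 0 < f i"
    and t: "0 < t" "t \<le> q"
    and ones: "(\<Sum>j<s. f j) + q = \<rho> * t"
    and row: "\<And>i. i < s \<Longrightarrow> (\<Sum>j<s. C_entry x i j * f j) + q = \<rho> * f i"
  shows "t \<le> f 0" "f (s - 1) \<le> t" "\<And>i. Suc i < s \<Longrightarrow> f i \<le> x * f (Suc i)"
proof -
  have "0 \<le> (\<Sum>j<s. f j)" using f by (intro sum_nonneg) (auto intro: less_imp_le)
  then have "0 < \<rho> * t" using t ones by linarith
  then have lam: "0 < \<rho>" using t by (simp add: zero_less_mult_iff)
  have "(\<Sum>j<s. f j) \<le> (\<Sum>j<s. C_entry x 0 j * f j)"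
    using x f by (intro sum_mono) (auto simp: C_entry_def)
  then have "\<rho> * t \<le> \<rho> * f 0" using ones row[of 0] s by simp
  then show t0: "t \<le> f 0" using lam by simp
  have "(\<Sum>j<s. C_entry x (s - 1) j * f j) \<le> (\<Sum>j<s. f j)"
  proof (intro sum_mono)
    fix j assume "j \<in> {..<s}"
    then have "C_entry x (s - 1) j \<le> 1" "0 < f j" using x f by (auto simp: C_entry_def)
    then show "C_entry x (s - 1) j * f j \<le> f j"
      by (metis less_imp_le mult_right_mono mult_1)
  qed
  then have "\<rho> * f (s - 1) \<le> \<rho> * t" using ones row[of "s - 1"] s by simp
  then show "f (s - 1) \<le> t" using lam by simp
  have "f 0 \<le> (\<Sum>j<s. f j)" using f s by (intro member_le_sum) (auto intro: less_imp_le)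
  then have "2 * t \<le> \<rho> * t" using t0 t ones by linarith
  then have lam2: "2 \<le> \<rho>" using t by simp
  fix i assume i: "Suc i < s"
  have "\<rho> * f i - \<rho> * f (Suc i) = (\<Sum>j<s. (C_entry x i j - C_entry x (Suc i) j) * f j)"
    using row[of i] row[of "Suc i"] i by (simp add: left_diff_distrib sum_subtractf)
  \<comment> \<open>Rows \<open>i\<close> and \<open>Suc i\<close> of the block differ only in
    columns \<open>i\<close> and \<open>Suc i\<close>.\<close>
  also have "\<dots> = (\<Sum>j\<in>{i, Suc i}. (C_entry x i j - C_entry x (Suc i) j) * f j)"
    using i by (intro sum.mono_neutral_right) (auto simp: C_entry_def)
  also have "\<dots> = (1 - 1 / x) * f i + (x - 1) * f (Suc i)"
    by (simp add: C_entry_def)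
  finally have eq: "(\<rho> - 1 + 1 / x) * f i = (\<rho> - 1 + x) * f (Suc i)"
    by (simp add: algebra_simps)
  \<comment> \<open>This product is exactly the gap between the two coefficients in
    \<open>eq\<close> once the first is multiplied by \<open>x\<close>; \<rho> \<ge> 2 makes it
    nonnegative.\<close>
  have "0 \<le> (x - 1) * (\<rho> - 2)" using x lam2 by simp
  also have "\<dots> = (\<rho> - 1 + 1 / x) * x - (\<rho> - 1 + x)" using x by (simp add: field_simps)
  finally have "(\<rho> - 1 + x) * f (Suc i) \<le> ((\<rho> - 1 + 1 / x) * x) * f (Suc i)"
    using f[OF i] by (intro mult_right_mono) auto
  then have "(\<rho> - 1 + 1 / x) * f i \<le> (\<rho> - 1 + 1 / x) * (x * f (Suc i))"
    using eq by (simp add: mult.assoc)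
  moreover have "0 < \<rho> - 1 + 1 / x" using lam2 x by (intro add_pos_pos) auto
  ultimately show "f i \<le> x * f (Suc i)" by simp
qed

text \<open>Read backwards, \<open>f\<close> satisfies the same equations with \<open>1 / x\<close>
  \<ge> 1 in place of \<open>x\<close>, so the previous bounds apply to the reversed
  sequence.\<close>

lemma C_eigenvector_bounds_reverse:
  fixes f :: "nat \<Rightarrow> real"
  assumes x: "0 < x" "x \<le> 1" and s: "s \<ge> 1" and f: "\<And>i. i < s \<Longrightarrow> 0 < f i"
    and t: "0 < t" "t \<le> q"
    and ones: "(\<Sum>j<s. f j) + q = \<rho> * t"
    and row: "\<And>i. i < s \<Longrightarrow> (\<Sum>j<s. C_entry x i j * f j) + q = \<rho> * f i"
  shows "t \<le> f (s - 1)" "f 0 \<le> t" "\<And>i. Suc i < s \<Longrightarrow> x * f (Suc i) \<le> f i"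
proof -
  let ?g = "\<lambda>i. f (s - Suc i)"
  have row': "(\<Sum>j<s. C_entry (1 / x) i j * ?g j) + q = \<rho> * ?g i" if i: "i < s" for i
  proof -
    have "(\<Sum>j<s. C_entry (1 / x) i j * ?g j) = (\<Sum>j<s. C_entry x (s - Suc i) (s - Suc j) * ?g j)"
      using i by (intro sum.cong) (auto simp: C_entry_reverse)
    also have "\<dots> = (\<Sum>j<s. C_entry x (s - Suc i) j * f j)"
      by (rule sum.nat_diff_reindex)
    finally show ?thesis using row[of "s - Suc i"] i by simp
  qed
  have ones': "(\<Sum>j<s. ?g j) + q = \<rho> * t"
    using ones sum.nat_diff_reindex[of f s] by simp
  have x1: "1 \<le> 1 / x" using x by simp
  have g: "0 < ?g i" if "i < s" for i using f[of "s - Suc i"] that by simp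
  have bounds: "t \<le> ?g 0" "?g (s - 1) \<le> t"
    "\<And>i. Suc i < s \<Longrightarrow> ?g i \<le> 1 / x * ?g (Suc i)"
    by (rule C_eigenvector_bounds[of "1 / x" s ?g t q \<rho>, OF x1 s g t ones' row']; assumption)+
  show "t \<le> f (s - 1)" "f 0 \<le> t" using bounds(1,2) s by auto
  fix i assume i: "Suc i < s"
  \<comment> \<open>The pair \<open>i\<close>, \<open>Suc i\<close> is the mirror image of
    \<open>s - Suc (Suc i)\<close> and its successor, in exchanged order.\<close>
  then have "s - Suc (s - Suc (Suc i)) = Suc i" "s - Suc (Suc (s - Suc (Suc i))) = i"
    "Suc (s - Suc (Suc i)) < s" by auto
  then have "f (Suc i) \<le> 1 / x * f i" using bounds(3)[of "s - Suc (Suc i)"] by simp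
  then show "x * f (Suc i) \<le> f i" using x by (simp add: field_simps)
qed

theorem theorem24:
  fixes x :: real and n s :: nat and A :: "real mat" and w :: "real vec"
  assumes "x > 0" and "s \<ge> 1" and "n > s"
    and "A = four_block_mat (C_mat s x) (J_mat s (n - s)) (J_mat (n - s) s) (J_mat (n - s) (n - s))"
    and "perron_eigenvector A w"
  shows "efficient A w"
proof -
  note x = assms(1) and s = assms(2) and n = assms(3)
  have dim: "dim_row A = n" "dim_col A = n"
    using n by (auto simp: assms(4) C_mat_def J_mat_def)
  have entry: "A $$ (i, j) = (if i < s \<and> j < s then C_entry x i j else 1)"
    if "i < n" "j < n" for i j
    using that n by (auto simp: assms(4) C_mat_def J_mat_def C_entry_def)
  have recip: "reciprocal_mat A"
    using x by (auto simp: reciprocal_mat_def positive_mat_def dim entry C_entry_def)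
  define \<rho> where "\<rho> = spectral_radius (map_mat complex_of_real A)"
  define t where "t = w $ s"
  define q where "q = (\<Sum>j=s..<n. w $ j)"
  have w: "w \<in> carrier_vec n" "positive_vec w" and eig: "A *\<^sub>v w = \<rho> \<cdot>\<^sub>v w"
    using assms(5) by (auto simp: perron_eigenvector_def eigenvector_def dim \<rho>_def)
  have pos: "0 < w $ i" if "i < n" for i
    using w that by (auto simp: positive_vec_def)
  have split: "(\<Sum>j<s. A $$ (i, j) * w $ j) + q = \<rho> * w $ i" if i: "i < n" for i
  proof -
    have "\<rho> * w $ i = (A *\<^sub>v w) $ i" using eig w(1) i by simp
    also have "\<dots> = (\<Sum>j=0..<n. A $$ (i, j) * w $ j)"
      using w(1) i by (simp add: dim scalar_prod_def)
    also have "\<dots> = (\<Sum>j=0..<s. A $$ (i, j) * w $ j) + (\<Sum>j=s..<n. A $$ (i, j) * w $ j)"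
      using n by (simp add: sum.atLeastLessThan_concat)
    also have "(\<Sum>j=s..<n. A $$ (i, j) * w $ j) = q"
      unfolding q_def using i by (intro sum.cong) (auto simp: entry)
    finally show ?thesis by (simp add: atLeast0LessThan)
  qed
  have ones: "(\<Sum>j<s. w $ j) + q = \<rho> * w $ k" if "s \<le> k" "k < n" for k
  proof -
    have "(\<Sum>j<s. A $$ (k, j) * w $ j) = (\<Sum>j<s. w $ j)"
      using that by (intro sum.cong) (auto simp: entry)
    then show ?thesis using split[of k] that by simp
  qed
  have row: "(\<Sum>j<s. C_entry x i j * w $ j) + q = \<rho> * w $ i" if "i < s" for i
  proof -
    have "(\<Sum>j<s. A $$ (i, j) * w $ j) = (\<Sum>j<s. C_entry x i j * w $ j)"
      using that n by (intro sum.cong) (auto simp: entry)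
    then show ?thesis using split[of i] that n by simp
  qed
  have tpos: "0 < t" using pos n by (simp add: t_def)
  have tq: "t \<le> q" unfolding t_def q_def
    using n pos by (intro member_le_sum) (auto intro: less_imp_le)
  have onest: "(\<Sum>j<s. w $ j) + q = \<rho> * t" using ones[of s] n by (simp add: t_def)
  have "0 < q" using tpos tq by simp
  moreover have "0 \<le> (\<Sum>j<s. w $ j)" using pos n by (intro sum_nonneg) (auto intro: less_imp_le)
  ultimately have "\<rho> \<noteq> 0" using onest by auto
  \<comment> \<open>The rows from \<open>s\<close> on are rows of ones, so \<rho> times the entry is
    the same for each of them, and \<rho> cancels.\<close>
  then have tail: "w $ k = t" if "s \<le> k" "k < n" for k
    using ones[OF that] onest by simp
  have fpos: "0 < w $ i" if "i < s" for i using pos that n by simp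
  let ?E = "dominance_graph A w"
  have E: "(i, j) \<in> ?E" if "i < n" "j < n" "A $$ (i, j) * w $ j \<le> w $ i" for i j
    using that pos[of j] by (auto simp: dominance_graph_def dim field_simps)
  have tail_edges: "(k, s) \<in> ?E" "(s, k) \<in> ?E" if "s \<le> k" "k < n" for k
    using that n by (auto intro!: E simp: entry tail)
  \<comment> \<open>Index \<open>s\<close>, the first one after the block, serves as a hub: strong
    connectivity follows once every index is joined to it in both directions.\<close>
  have hub: "(i, s) \<in> ?E\<^sup>* \<and> (s, i) \<in> ?E\<^sup>*" if i: "i < s" for i
  proof (cases "x \<ge> 1")
    case True
    have b: "t \<le> w $ 0" "w $ (s - 1) \<le> t" "\<And>j. Suc j < s \<Longrightarrow> w $ j \<le> x * w $ Suc j"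
      by (rule C_eigenvector_bounds[of x s "\<lambda>i. w $ i" t q \<rho>,
            OF True s fpos tpos tq onest row]; assumption)+
    have "(Suc j, j) \<in> ?E" if "Suc j < s" for j
      using b(3)[OF that] that n x by (intro E) (auto simp: entry C_entry_def field_simps)
    \<comment> \<open>The edges descend when \<open>x\<close> \<ge> 1, so the path lemma is applied
      to the converse relation.\<close>
    then have path: "(k, j) \<in> ?E\<^sup>*" if "j \<le> k" "k < s" for j k
      using increasing_path_in_rtrancl[of s "?E\<inverse>" j k] that by (simp add: rtrancl_converse)
    have "(0, s) \<in> ?E" "(s, s - 1) \<in> ?E"
      using b(1,2) n s by (auto intro!: E simp: entry tail)
    moreover have "(i, 0) \<in> ?E\<^sup>*" "(s - 1, i) \<in> ?E\<^sup>*"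
      using path[of 0 i] path[of i "s - 1"] i by auto
    ultimately show ?thesis
      by (meson rtrancl.rtrancl_into_rtrancl converse_rtrancl_into_rtrancl)
  next
    case False
    then have x1: "x \<le> 1" by simp
    have b: "t \<le> w $ (s - 1)" "w $ 0 \<le> t" "\<And>j. Suc j < s \<Longrightarrow> x * w $ Suc j \<le> w $ j"
      by (rule C_eigenvector_bounds_reverse[of x s "\<lambda>i. w $ i" t q \<rho>,
            OF x x1 s fpos tpos tq onest row]; assumption)+
    have "(j, Suc j) \<in> ?E" if "Suc j < s" for j
      using b(3)[OF that] that n x by (intro E) (auto simp: entry C_entry_def)
    then have path: "(j, k) \<in> ?E\<^sup>*" if "j \<le> k" "k < s" for j k
      using increasing_path_in_rtrancl[of s ?E j k] that by simp
    have "(s - 1, s) \<in> ?E" "(s, 0) \<in> ?E"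
      using b(1,2) n s by (auto intro!: E simp: entry tail)
    moreover have "(i, s - 1) \<in> ?E\<^sup>*" "(0, i) \<in> ?E\<^sup>*"
      using path[of 0 i] path[of i "s - 1"] i by auto
    ultimately show ?thesis
      by (meson rtrancl.rtrancl_into_rtrancl converse_rtrancl_into_rtrancl)
  qed
  have "(i, s) \<in> ?E\<^sup>* \<and> (s, i) \<in> ?E\<^sup>*" if "i < n" for i
    using hub[of i] tail_edges[of i] that by (cases "i < s") auto
  then have "(i, j) \<in> ?E\<^sup>*" if "i < n" "j < n" for i j
    using that by (meson rtrancl_trans)
  then show ?thesis
    using recip w by (intro efficient_if_strongly_connected) (auto simp: dim)
qed

end
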